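(* Let $\mathcal{X}\in\mathbb{C}^{I_1\times\cdots\times I_N}$ be a tensor with an independent Tucker decomposition $\mathcal{X}=[\![\mathcal{G};\mathbf{X}^{(1)},\ldots,\mathbf{X}^{(N)}]\!]$, where $\mathcal{G}\in\mathbb{C}^{J_1\times\cdots\times J_N}$ and $\mathbf{X}^{(n)}\in\mathbb{C}^{I_n\times J_n}$. Then $$\alpha\|\mathcal{G}\|_F\le\|\mathcal{X}\|_F\le\beta\|\mathcal{G}\|_F,$$ where $\beta=\|\mathbf{X}^{(1)}\|_2\|\mathbf{X}^{(2)}\|_2\cdots\|\mathbf{X}^{(N)}\|_2$ and $\alpha=\beta/\prod_{n=1}^N\kappa(\mathbf{X}^{(n)})$, with $\kappa(\mathbf{X}^{(n)})$ the condition number of the matrix $\mathbf{X}^{(n)}$.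
   Context: Mode-$n$ product: for $\mathcal{X}\in\mathbb{C}^{I_1\times\cdots\times I_N}$ and a matrix $\mathbf{A}\in\mathbb{C}^{J\times I_n}$, $[\mathcal{X}\times_n\mathbf{A}]_{i_1\cdots i_{n-1}ji_{n+1}\cdots i_N}=\sum_{i_n=1}^{I_n}x_{i_1\cdots i_N}a_{ji_n}$. Tucker decomposition: $\mathcal{X}=[\![\mathcal{G};\mathbf{X}^{(1)},\ldots,\mathbf{X}^{(N)}]\!]$ means $\mathcal{X}=\mathcal{G}\times_1\mathbf{X}^{(1)}\times_2\cdots\times_N\mathbf{X}^{(N)}$; it is independent if every factor matrix $\mathbf{X}^{(n)}$ has full column rank. $\|\mathcal{X}\|_F=\big(\sum_{i_1,\ldots,i_N}|x_{i_1\cdots i_N}|^2\big)^{1/2}$ is the Frobenius norm. For a matrix $\mathbf{A}$, $\|\mathbf{A}\|_2=\sigma_{\max}(\mathbf{A})$ is the spectral norm, and $\kappa(\mathbf{A})=\sigma_{\max}(\mathbf{A})/\sigma_{\min}(\mathbf{A})$ with $\sigma_{\max},\sigma_{\min}$ the largest and smallest singular values (for a full-column-rank $I\times J$ matrix, there are $J$ singular values, all positive). *)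

theory Defs
  imports
    Complex_Main
    "Jordan_Normal_Form.DL_Rank"
    "Jordan_Normal_Form.Schur_Decomposition"
begin

definition multi_indices :: "nat list \<Rightarrow> nat list set" where
  "multi_indices ds = {is. length is = length ds \<and> (\<forall>n<length ds. is ! n < ds ! n)}"

text \<open>A tensor is a list of dimensions together with an entry function on the multi-indices. Both
  modes and indices are counted from 0. Entries outside the range are fixed, so that equality of
  tensors is equality of dimensions and of entries (as for \<^typ>\<open>'a mat\<close>).\<close>

typedef 'a tensor = "{(ds :: nat list, f :: nat list \<Rightarrow> 'a). f \<in> extensional (multi_indices ds)}"
proof -
  have "([], restrict (\<lambda>_. undefined) (multi_indices []))
    \<in> {(ds :: nat list, f :: nat list \<Rightarrow> 'a). f \<in> extensional (multi_indices ds)}"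
    by simp
  then show ?thesis by blast
qed

definition tdims :: "'a tensor \<Rightarrow> nat list" where
  "tdims T = fst (Rep_tensor T)"

definition entry :: "'a tensor \<Rightarrow> nat list \<Rightarrow> 'a" where
  "entry T = snd (Rep_tensor T)"

definition mk_tensor :: "nat list \<Rightarrow> (nat list \<Rightarrow> 'a) \<Rightarrow> 'a tensor" where
  "mk_tensor ds f = Abs_tensor (ds, restrict f (multi_indices ds))"

definition carrier_tensor :: "nat list \<Rightarrow> 'a tensor set" where
  "carrier_tensor ds = {T. tdims T = ds}"

lemma Rep_mk_tensor: "Rep_tensor (mk_tensor ds f) = (ds, restrict f (multi_indices ds))"
  unfolding mk_tensor_def by (rule Abs_tensor_inverse) simp

lemma tdims_mk_tensor [simp]: "tdims (mk_tensor ds f) = ds"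
  by (simp add: tdims_def Rep_mk_tensor)

lemma entry_mk_tensor [simp]: "is \<in> multi_indices ds \<Longrightarrow> entry (mk_tensor ds f) is = f is"
  by (simp add: entry_def Rep_mk_tensor)

lemma tensor_eqI:
  assumes "tdims S = tdims T"
    and "\<And>is. is \<in> multi_indices (tdims T) \<Longrightarrow> entry S is = entry T is"
  shows "S = T"
proof -
  have ext: "entry U \<in> extensional (multi_indices (tdims U))" for U :: "'a tensor"
    using Rep_tensor[of U] by (auto simp: entry_def tdims_def)
  have "entry S = entry T"
    using assms ext[of S] ext[of T] by (metis extensionalityI)
  then have "Rep_tensor S = Rep_tensor T"
    using assms(1) by (simp add: entry_def tdims_def prod_eq_iff)
  then show ?thesis by (simp add: Rep_tensor_inject)
qed

text \<open>Meaningful when \<^prop>\<open>n < length (tdims T)\<close> and \<^prop>\<open>dim_col A = tdims T ! n\<close>.\<close>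

definition mode_prod :: "'a :: comm_semiring_1 tensor \<Rightarrow> nat \<Rightarrow> 'a mat \<Rightarrow> 'a tensor" where
  "mode_prod T n A = mk_tensor ((tdims T)[n := dim_row A])
     (\<lambda>is. \<Sum>k<tdims T ! n. entry T (is[n := k]) * A $$ (is ! n, k))"

text \<open>\<open>tucker N G X\<close> is G multiplied by \<open>X 0\<close> in mode 0, then by \<open>X 1\<close> in mode 1, and so on
  up to mode \<open>N - 1\<close>.\<close>

fun tucker :: "nat \<Rightarrow> 'a :: comm_semiring_1 tensor \<Rightarrow> (nat \<Rightarrow> 'a mat) \<Rightarrow> 'a tensor" where
  "tucker 0 G X = G"
| "tucker (Suc n) G X = mode_prod (tucker n G X) n (X n)"

definition full_column_rank :: "'a :: field mat \<Rightarrow> bool" where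
  "full_column_rank A \<longleftrightarrow> vec_space.rank (dim_row A) A = dim_col A"

definition independent_tucker ::
    "nat \<Rightarrow> 'a :: field tensor \<Rightarrow> 'a tensor \<Rightarrow> (nat \<Rightarrow> 'a mat) \<Rightarrow> bool" where
  "independent_tucker N T G X \<longleftrightarrow> T = tucker N G X \<and> (\<forall>n<N. full_column_rank (X n))"

definition frobenius_norm :: "complex tensor \<Rightarrow> real" where
  "frobenius_norm T = sqrt (\<Sum>is\<in>multi_indices (tdims T). (cmod (entry T is))\<^sup>2)"

text \<open>The smaller of the two Gram matrices is used, because an m by n matrix has min(m, n) singular
  values: for a full-column-rank matrix these are the square roots of the eigenvalues of
  \<^term>\<open>mat_adjoint A * A\<close>. Multiplicities are irrelevant for the extreme values below.\<close>

definition singular_values :: "complex mat \<Rightarrow> real set" where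
  "singular_values A = {\<sigma>. \<sigma> \<ge> 0 \<and>
     eigenvalue (if dim_col A \<le> dim_row A then mat_adjoint A * A else A * mat_adjoint A)
       (complex_of_real (\<sigma>\<^sup>2))}"

definition sigma_max :: "complex mat \<Rightarrow> real" where
  "sigma_max A = Max (singular_values A)"

definition sigma_min :: "complex mat \<Rightarrow> real" where
  "sigma_min A = Min (singular_values A)"

definition spectral_norm :: "complex mat \<Rightarrow> real" where
  "spectral_norm A = sigma_max A"

definition condition_number :: "complex mat \<Rightarrow> real" where
  "condition_number A = sigma_max A / sigma_min A"

end

theory Submission
  imports Defs "Jordan_Normal_Form.Spectral_Radius" "HOL-Analysis.L2_Norm"
begin

text \<open>Mode by mode, a mode-n product applies the matrix to every mode-n fibre of the tensor, so it
  scales the Frobenius norm by a factor between the extreme singular values of the matrix; moreover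
  \<open>\<beta> / \<Prod>\<kappa>\<close> is the product of the smallest singular values. The bounds for a single matrix are
  the extremal property of the eigenvalues of its Gram matrix. This is obtained without a spectral
  theorem or compactness: if s is the largest number with s |v|^2 \<open>\<le>\<close> (Hv, v) for all v, then the
  positive semidefinite matrix H - s cannot be invertible, since it would otherwise be coercive and
  s could be increased.\<close>

section \<open>Squared norms, adjoints and crude bounds for complex matrices\<close>

definition sq_norm_cvec :: "complex vec \<Rightarrow> real" where
  "sq_norm_cvec v = (\<Sum>i<dim_vec v. (cmod (v $ i))\<^sup>2)"

lemma sq_norm_cvec_nonneg: "0 \<le> sq_norm_cvec v"
  by (simp add: sq_norm_cvec_def sum_nonneg)

lemma cscalar_prod_self: "v \<bullet>c v = complex_of_real (sq_norm_cvec v)"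
  unfolding sq_norm_cvec_def scalar_prod_def
  by (simp add: atLeast0LessThan flip: complex_norm_square)

lemma sq_norm_cvec_pos:
  assumes "v \<in> carrier_vec n" "v \<noteq> 0\<^sub>v n"
  shows "0 < sq_norm_cvec v"
proof -
  have "v \<bullet>c v \<noteq> 0"
    using assms by simp
  then show ?thesis
    using sq_norm_cvec_nonneg[of v] by (auto simp: cscalar_prod_self order_less_le)
qed

lemma dim_row_mat_adjoint [simp]: "dim_row (mat_adjoint A) = dim_col A"
  and dim_col_mat_adjoint [simp]: "dim_col (mat_adjoint A) = dim_row A"
  by (simp_all add: mat_adjoint_def)

lemma index_mat_adjoint [simp]:
  "i < dim_col A \<Longrightarrow> j < dim_row A \<Longrightarrow> mat_adjoint A $$ (i, j) = conjugate (A $$ (j, i))"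
  by (simp add: mat_adjoint_def mat_of_rows_index)

lemma cscalar_prod_mat_adjoint:
  fixes A :: "complex mat"
  assumes "A \<in> carrier_mat m n" "v \<in> carrier_vec n" "w \<in> carrier_vec m"
  shows "(A *\<^sub>v v) \<bullet>c w = v \<bullet>c (mat_adjoint A *\<^sub>v w)"
proof -
  have "(A *\<^sub>v v) \<bullet>c w = (\<Sum>i<m. \<Sum>j<n. A $$ (i, j) * v $ j * cnj (w $ i))"
    using assms by (simp add: scalar_prod_def atLeast0LessThan sum_distrib_right)
  also have "\<dots> = (\<Sum>j<n. \<Sum>i<m. A $$ (i, j) * v $ j * cnj (w $ i))"
    by (rule sum.swap)
  also have "\<dots> = v \<bullet>c (mat_adjoint A *\<^sub>v w)"
    using assms
    by (simp add: scalar_prod_def atLeast0LessThan sum_distrib_left ac_simps)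
  finally show ?thesis .
qed

text \<open>Cauchy-Schwarz in each row gives the squared Frobenius norm of \<open>A\<close> as a
  constant. Sharpness does not matter, since this only supplies finite bounds for the argument about
  Hermitian forms; the summand 1 makes \<open>C\<close> positive, so that one may divide by
  it.\<close>

lemma sq_norm_cvec_mult_mat_le:
  fixes A :: "complex mat"
  assumes A: "A \<in> carrier_mat m n"
  obtains C where "0 < C"
    "\<And>v. v \<in> carrier_vec n \<Longrightarrow> sq_norm_cvec (A *\<^sub>v v) \<le> C * sq_norm_cvec v"
proof
  let ?C = "1 + (\<Sum>i<m. \<Sum>j<n. (cmod (A $$ (i, j)))\<^sup>2)"
  show "0 < ?C"
    by (intro add_pos_nonneg sum_nonneg) auto
  fix v :: "complex vec" assume v: "v \<in> carrier_vec n"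
  have row: "(cmod ((A *\<^sub>v v) $ i))\<^sup>2 \<le> (\<Sum>j<n. (cmod (A $$ (i, j)))\<^sup>2) * sq_norm_cvec v"
    if "i < m" for i
  proof -
    have "cmod ((A *\<^sub>v v) $ i) = cmod (\<Sum>j<n. A $$ (i, j) * v $ j)"
      using A v that by (simp add: scalar_prod_def atLeast0LessThan)
    also have "\<dots> \<le> (\<Sum>j<n. \<bar>cmod (A $$ (i, j))\<bar> * \<bar>cmod (v $ j)\<bar>)"
      by (rule order_trans[OF norm_sum]) (simp add: norm_mult)
    also have "\<dots> \<le> L2_set (\<lambda>j. cmod (A $$ (i, j))) {..<n} * L2_set (\<lambda>j. cmod (v $ j)) {..<n}"
      by (rule L2_set_mult_ineq)
    finally have "(cmod ((A *\<^sub>v v) $ i))\<^sup>2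
        \<le> (L2_set (\<lambda>j. cmod (A $$ (i, j))) {..<n} * L2_set (\<lambda>j. cmod (v $ j)) {..<n})\<^sup>2"
      by (rule power_mono) simp
    also have "\<dots> = (\<Sum>j<n. (cmod (A $$ (i, j)))\<^sup>2) * sq_norm_cvec v"
      using v by (simp add: power_mult_distrib L2_set_def sum_nonneg sq_norm_cvec_def)
    finally show ?thesis .
  qed
  have "sq_norm_cvec (A *\<^sub>v v) \<le> (\<Sum>i<m. \<Sum>j<n. (cmod (A $$ (i, j)))\<^sup>2) * sq_norm_cvec v"
    using A sum_mono[OF row, of "{..<m}"]
    by (simp add: sq_norm_cvec_def[of "A *\<^sub>v v"] sum_distrib_right del: index_mult_mat_vec)
  then show "sq_norm_cvec (A *\<^sub>v v) \<le> ?C * sq_norm_cvec v"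
    using sq_norm_cvec_nonneg[of v] by (simp add: distrib_right)
qed

text \<open>The inequality 2ab <= a^2 + b^2 for the moduli, summed over the coordinates; it keeps
  square roots out of the estimates.\<close>

lemma abs_Re_cscalar_prod_le:
  fixes v w :: "complex vec"
  assumes "v \<in> carrier_vec n" "w \<in> carrier_vec n"
  shows "2 * \<bar>Re (v \<bullet>c w)\<bar> \<le> sq_norm_cvec v + sq_norm_cvec w"
proof -
  have pt: "2 * \<bar>Re (a * cnj b)\<bar> \<le> (cmod a)\<^sup>2 + (cmod b)\<^sup>2" for a b :: complex
  proof -
    have "\<bar>Re (a * cnj b)\<bar> \<le> cmod a * cmod b"
      using abs_Re_le_cmod[of "a * cnj b"] by (simp add: norm_mult)
    moreover have "0 \<le> (cmod a - cmod b)\<^sup>2" by simp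
    ultimately show ?thesis by (simp add: power2_diff)
  qed
  have "2 * \<bar>Re (v \<bullet>c w)\<bar> = 2 * \<bar>\<Sum>i<n. Re (v $ i * cnj (w $ i))\<bar>"
    using assms by (simp add: scalar_prod_def atLeast0LessThan)
  also have "\<dots> \<le> (\<Sum>i<n. 2 * \<bar>Re (v $ i * cnj (w $ i))\<bar>)"
    unfolding sum_distrib_left[symmetric] by (intro mult_left_mono sum_abs) simp
  also have "\<dots> \<le> (\<Sum>i<n. (cmod (v $ i))\<^sup>2 + (cmod (w $ i))\<^sup>2)"
    by (intro sum_mono pt)
  also have "\<dots> = sq_norm_cvec v + sq_norm_cvec w"
    using assms by (simp add: sq_norm_cvec_def sum.distrib)
  finally show ?thesis .
qed

section \<open>Hermitian forms and their least eigenvalue\<close>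

lemma quadratic_form_bounded:
  fixes K :: "complex mat"
  assumes K: "K \<in> carrier_mat n n"
  obtains M where "0 < M"
    "\<And>v. v \<in> carrier_vec n \<Longrightarrow> \<bar>Re ((K *\<^sub>v v) \<bullet>c v)\<bar> \<le> M * sq_norm_cvec v"
proof -
  obtain C where C: "0 < C"
    "\<And>v. v \<in> carrier_vec n \<Longrightarrow> sq_norm_cvec (K *\<^sub>v v) \<le> C * sq_norm_cvec v"
    using sq_norm_cvec_mult_mat_le[OF K] by metis
  show thesis
  proof
    \<comment> \<open>The constant comes from 2 |(Kv, v)| <= |Kv|^2 + |v|^2 <= (C + 1) |v|^2, with
      real parts of the form understood.\<close>
    show "0 < (C + 1) / 2" using C(1) by simp
    fix v :: "complex vec" assume v: "v \<in> carrier_vec n"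
    have "2 * \<bar>Re ((K *\<^sub>v v) \<bullet>c v)\<bar> \<le> sq_norm_cvec (K *\<^sub>v v) + sq_norm_cvec v"
      using K v by (intro abs_Re_cscalar_prod_le[of _ n]) auto
    also have "\<dots> \<le> (C + 1) * sq_norm_cvec v"
      using C(2)[OF v] by (simp add: distrib_right)
    finally show "\<bar>Re ((K *\<^sub>v v) \<bullet>c v)\<bar> \<le> (C + 1) / 2 * sq_norm_cvec v" by simp
  qed
qed

text \<open>Two estimates are chained through w = Kv. Semidefiniteness and the bound
  \<open>M\<close> of the form give |w|^2 <= M (Kv, v); the inverse \<open>B\<close>, with bound
  \<open>D\<close>, gives |v|^2 = |Bw|^2 <= D |w|^2. Hence c = 1 / (M D).\<close>

lemma hermitian_form_coercive:
  fixes K :: "complex mat"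
  assumes K: "K \<in> carrier_mat n n" and herm: "mat_adjoint K = K"
    and psd: "\<And>v. v \<in> carrier_vec n \<Longrightarrow> 0 \<le> Re ((K *\<^sub>v v) \<bullet>c v)"
    and det: "det K \<noteq> 0"
  obtains c where "0 < c"
    "\<And>v. v \<in> carrier_vec n \<Longrightarrow> c * sq_norm_cvec v \<le> Re ((K *\<^sub>v v) \<bullet>c v)"
proof -
  obtain B where B: "B \<in> carrier_mat n n" "B * K = 1\<^sub>m n"
    using det_non_zero_imp_unit[OF K det, of "()"] unfolding Units_def ring_mat_def by auto
  obtain M where M: "0 < M"
    "\<And>v. v \<in> carrier_vec n \<Longrightarrow> \<bar>Re ((K *\<^sub>v v) \<bullet>c v)\<bar> \<le> M * sq_norm_cvec v"
    using quadratic_form_bounded[OF K] by metis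
  obtain D where D: "0 < D"
    "\<And>v. v \<in> carrier_vec n \<Longrightarrow> sq_norm_cvec (B *\<^sub>v v) \<le> D * sq_norm_cvec v"
    using sq_norm_cvec_mult_mat_le[OF B(1)] by metis
  show thesis
  proof
    show "0 < 1 / (M * D)" using M(1) D(1) by simp
    fix v :: "complex vec" assume v: "v \<in> carrier_vec n"
    define w where "w = K *\<^sub>v v"
    have w: "w \<in> carrier_vec n" and Kw: "K *\<^sub>v w \<in> carrier_vec n"
      unfolding w_def using K v by simp_all
    have inv: "B *\<^sub>v w = v"
      unfolding w_def using assoc_mult_mat_vec[OF B(1) K v] B(2) v by simp
    \<comment> \<open>Expanding 0 \<open>\<le>\<close> (Ku, u) at u = v - Kv / M gives |Kv|^2 / M \<open>\<le>\<close> (Kv, v).\<close>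
    define t :: complex where "t = complex_of_real (1 / M)"
    define u where "u = v - t \<cdot>\<^sub>v w"
    have u: "u \<in> carrier_vec n" using v w by (simp add: u_def)
    have Ku: "K *\<^sub>v u = w - t \<cdot>\<^sub>v (K *\<^sub>v w)"
      unfolding u_def using K v w
      by (simp add: mult_minus_distrib_mat_vec[of _ n n] mult_mat_vec[of _ n n] flip: w_def)
    have cu: "conjugate u = conjugate v - t \<cdot>\<^sub>v conjugate w"
      using v w by (intro eq_vecI) (auto simp: u_def t_def)
    \<comment> \<open>Since K is Hermitian, (Kw, v) = (w, Kv) = |w|^2, so both cross terms of the
      expansion are multiples of |w|^2.\<close>
    have "(K *\<^sub>v w) \<bullet>c v = w \<bullet>c w"
      using cscalar_prod_mat_adjoint[OF K w v] by (simp add: herm w_def)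
    then have "(K *\<^sub>v u) \<bullet>c u
        = w \<bullet>c v - 2 * t * (w \<bullet>c w) + t\<^sup>2 * ((K *\<^sub>v w) \<bullet>c w)"
      unfolding Ku cu using v w Kw
      by (simp add: minus_scalar_prod_distrib[of _ n] scalar_prod_minus_distrib[of _ n]
          power2_eq_square algebra_simps)
    then have "Re ((K *\<^sub>v u) \<bullet>c u)
        = Re (w \<bullet>c v) - 2 * (1 / M) * sq_norm_cvec w + (1 / M)\<^sup>2 * Re ((K *\<^sub>v w) \<bullet>c w)"
      by (simp add: t_def cscalar_prod_self flip: of_real_power of_real_divide)
    \<comment> \<open>The quadratic term is at most |w|^2 / M and thus cancels only half of the
      cross terms -2 |w|^2 / M.\<close>
    also have "(1 / M)\<^sup>2 * Re ((K *\<^sub>v w) \<bullet>c w) \<le> (1 / M)\<^sup>2 * (M * sq_norm_cvec w)"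
      using M(2)[OF w] by (intro mult_left_mono) auto
    also have "(1 / M)\<^sup>2 * (M * sq_norm_cvec w) = 1 / M * sq_norm_cvec w"
      using M(1) by (simp add: power2_eq_square)
    finally have "1 / M * sq_norm_cvec w \<le> Re (w \<bullet>c v)"
      using psd[OF u] by simp
    moreover have "sq_norm_cvec v \<le> D * sq_norm_cvec w"
      using D(2)[OF w] inv by simp
    then have "1 / (M * D) * sq_norm_cvec v \<le> 1 / M * sq_norm_cvec w"
      using M(1) D(1) by (simp add: field_simps)
    ultimately show "1 / (M * D) * sq_norm_cvec v \<le> Re ((K *\<^sub>v v) \<bullet>c v)"
      by (simp add: w_def)
  qed
qed

text \<open>A lower bound is enough for both ends of the spectrum: applied to -H, it yields an
  eigenvalue of H that bounds the form from above.\<close>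

lemma hermitian_eigenvalue_lower_bound:
  fixes H :: "complex mat"
  assumes H: "H \<in> carrier_mat n n" and herm: "mat_adjoint H = H" and n: "0 < n"
  obtains s :: real where "eigenvalue H (complex_of_real s)"
    "\<And>v. v \<in> carrier_vec n \<Longrightarrow> s * sq_norm_cvec v \<le> Re ((H *\<^sub>v v) \<bullet>c v)"
proof -
  define S where "S = {t. \<forall>v\<in>carrier_vec n. t * sq_norm_cvec v \<le> Re ((H *\<^sub>v v) \<bullet>c v)}"
  obtain M where M: "0 < M"
    "\<And>v. v \<in> carrier_vec n \<Longrightarrow> \<bar>Re ((H *\<^sub>v v) \<bullet>c v)\<bar> \<le> M * sq_norm_cvec v"
    using quadratic_form_bounded[OF H] by metis
  have "- M \<in> S"
    unfolding S_def using M(2) by fastforce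
  then have ne: "S \<noteq> {}" by blast
  \<comment> \<open>Any nonzero vector bounds \<open>S\<close> above by its Rayleigh quotient; a
    positive dimension provides one.\<close>
  have e: "0 < sq_norm_cvec (unit_vec n 0)"
    using n by (intro sq_norm_cvec_pos[of _ n]) auto
  have bdd: "bdd_above S"
  proof (rule bdd_aboveI)
    fix t assume "t \<in> S"
    then have "t * sq_norm_cvec (unit_vec n 0) \<le> Re ((H *\<^sub>v unit_vec n 0) \<bullet>c unit_vec n 0)"
      unfolding S_def by simp
    with e show "t \<le> Re ((H *\<^sub>v unit_vec n 0) \<bullet>c unit_vec n 0) / sq_norm_cvec (unit_vec n 0)"
      by (simp add: pos_le_divide_eq)
  qed
  define s where "s = Sup S"
  \<comment> \<open>The supremum itself lies in \<open>S\<close>: each Rayleigh quotient is an upper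
    bound of \<open>S\<close>, hence at least \<open>s\<close>.\<close>
  have s: "s * sq_norm_cvec v \<le> Re ((H *\<^sub>v v) \<bullet>c v)" if v: "v \<in> carrier_vec n" for v
  proof (cases "v = 0\<^sub>v n")
    case True
    then show ?thesis using H by (simp add: sq_norm_cvec_def)
  next
    case False
    then have pos: "0 < sq_norm_cvec v" using v sq_norm_cvec_pos by blast
    have "s \<le> Re ((H *\<^sub>v v) \<bullet>c v) / sq_norm_cvec v"
      unfolding s_def using ne pos v by (intro cSup_least) (auto simp: S_def pos_le_divide_eq)
    then show ?thesis using pos by (simp add: pos_le_divide_eq)
  qed
  \<comment> \<open>\<open>char_matrix\<close> gives H - s, whose determinant vanishes exactly when
    \<open>s\<close> is an eigenvalue.\<close>
  define K where "K = char_matrix H (complex_of_real s)"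
  have K: "K \<in> carrier_mat n n" unfolding K_def using H by simp
  have Kv: "Re ((K *\<^sub>v v) \<bullet>c v) = Re ((H *\<^sub>v v) \<bullet>c v) - s * sq_norm_cvec v"
    if v: "v \<in> carrier_vec n" for v
  proof -
    have "K *\<^sub>v v = H *\<^sub>v v - complex_of_real s \<cdot>\<^sub>v v"
      using H v unfolding K_def char_matrix_def
      by (intro eq_vecI) (auto simp: add_mult_distrib_mat_vec[of _ n n])
    then have "(K *\<^sub>v v) \<bullet>c v = (H *\<^sub>v v) \<bullet>c v - complex_of_real s * (v \<bullet>c v)"
      using H v by (simp add: minus_scalar_prod_distrib[of _ n])
    then show ?thesis by (simp add: cscalar_prod_self)
  qed
  have hermK: "mat_adjoint K = K"
  proof (intro eq_matI)
    fix i j assume ij: "i < dim_row K" "j < dim_col K"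
    then have "cnj (H $$ (j, i)) = H $$ (i, j)"
      using H K arg_cong[OF herm, of "\<lambda>A. A $$ (i, j)"] by simp
    then show "mat_adjoint K $$ (i, j) = K $$ (i, j)"
      using ij H K by (simp add: K_def char_matrix_def)
  qed (use K in auto)
  have "det K = 0"
  proof (rule ccontr)
    assume "det K \<noteq> 0"
    then obtain c where c: "0 < c"
      "\<And>v. v \<in> carrier_vec n \<Longrightarrow> c * sq_norm_cvec v \<le> Re ((K *\<^sub>v v) \<bullet>c v)"
      using hermitian_form_coercive[OF K hermK] s Kv by (metis diff_ge_0_iff_ge)
    have "s + c \<in> S"
      unfolding S_def using c(2) Kv by (auto simp: distrib_right algebra_simps)
    then have "s + c \<le> s" unfolding s_def using bdd by (rule cSup_upper)
    with c(1) show False by simp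
  qed
  then have "eigenvalue H (complex_of_real s)"
    using eigenvalue_det[OF H] K_def by simp
  with s show thesis using that by blast
qed

section \<open>Gram matrices and extreme singular values\<close>

lemma mat_adjoint_adjoint [simp]: "mat_adjoint (mat_adjoint A) = A"
  by (intro eq_matI) auto

lemma mat_adjoint_mult:
  assumes "A \<in> carrier_mat m n" "B \<in> carrier_mat n k"
  shows "mat_adjoint (A * B) = mat_adjoint B * mat_adjoint A"
  using assms
  by (intro eq_matI)
     (auto simp: scalar_prod_def sum_conjugate conjugate_dist_mul mult.commute intro!: sum.cong)

text \<open>The rank is the size of a maximal independent set of columns, which cannot exceed the
  dimension of the ambient space. The inequality selects \<open>mat_adjoint A * A\<close> as the
  Gram matrix in \<open>singular_values\<close>.\<close>

lemma full_column_rank_dim_le: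
  assumes "full_column_rank A"
  shows "dim_col A \<le> dim_row A"
proof -
  define n where "n = dim_row A"
  have A: "A \<in> carrier_mat n (dim_col A)" by (simp add: n_def)
  interpret vec_space "TYPE('a)" n .
  obtain U where U: "maximal U (\<lambda>T. T \<subseteq> set (cols A) \<and> lin_indpt T)"
    using maximal_exists_superset[of "set (cols A)" "\<lambda>T. T \<subseteq> set (cols A) \<and> lin_indpt T" "{}"]
    by (auto simp: lin_dep_def)
  then have "U \<subseteq> set (cols A)" and indpt: "lin_indpt U"
    by (auto simp: maximal_def)
  then have "U \<subseteq> carrier_vec n"
    using A cols_dim[of A] n_def by blast
  then have "card U \<le> n"
    using li_le_dim(2)[OF fin_dim _ indpt] dim_is_n by simp
  with rank_card_indpt[OF A U] assms show ?thesis
    by (simp add: full_column_rank_def n_def)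
qed

text \<open>Needed for \<open>Max\<close> and \<open>Min\<close> to be genuine extrema. A singular
  value is recovered from its eigenvalue by a square root, and a spectrum is finite.\<close>

lemma finite_singular_values: "finite (singular_values A)"
proof -
  define H where "H = (if dim_col A \<le> dim_row A then mat_adjoint A * A else A * mat_adjoint A)"
  have "H \<in> carrier_mat (dim_row H) (dim_row H)"
    by (auto simp: H_def)
  then have "finite (spectrum H)"
    by (rule card_finite_spectrum)
  moreover have "singular_values A \<subseteq> (\<lambda>z. sqrt (Re z)) ` spectrum H"
  proof
    fix x assume "x \<in> singular_values A"
    then have "0 \<le> x" "complex_of_real (x\<^sup>2) \<in> spectrum H"
      by (auto simp: singular_values_def spectrum_def H_def)
    then show "x \<in> (\<lambda>z. sqrt (Re z)) ` spectrum H"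
      by (intro image_eqI[of _ _ "complex_of_real (x\<^sup>2)"]) auto
  qed
  ultimately show ?thesis
    by (meson finite_imageI finite_subset)
qed

text \<open>With H the Gram matrix, (Hv, v) = |Av|^2, so the eigenvalue bounds for H and for -H
  become bounds on |Av|^2.\<close>

lemma
  assumes A: "A \<in> carrier_mat m n" and n: "0 < n" "n \<le> m"
  shows sigma_min_nonneg: "0 \<le> sigma_min A"
    and sigma_min_le_sigma_max: "sigma_min A \<le> sigma_max A"
    and sigma_min_bound: "v \<in> carrier_vec n \<Longrightarrow>
      (sigma_min A)\<^sup>2 * sq_norm_cvec v \<le> sq_norm_cvec (A *\<^sub>v v)"
    and sigma_max_bound: "v \<in> carrier_vec n \<Longrightarrow>
      sq_norm_cvec (A *\<^sub>v v) \<le> (sigma_max A)\<^sup>2 * sq_norm_cvec v"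
proof -
  define H where "H = mat_adjoint A * A"
  have A': "mat_adjoint A \<in> carrier_mat n m" using A by auto
  have H: "H \<in> carrier_mat n n" using A A' by (simp add: H_def)
  have herm: "mat_adjoint H = H"
    unfolding H_def using mat_adjoint_mult[OF A' A] by simp
  have form: "(H *\<^sub>v v) \<bullet>c v = complex_of_real (sq_norm_cvec (A *\<^sub>v v))"
    if v: "v \<in> carrier_vec n" for v
  proof -
    have Av: "A *\<^sub>v v \<in> carrier_vec m" using A v by simp
    have "(H *\<^sub>v v) \<bullet>c v = (mat_adjoint A *\<^sub>v (A *\<^sub>v v)) \<bullet>c v"
      unfolding H_def using assoc_mult_mat_vec[OF A' A v] by simp
    also have "\<dots> = (A *\<^sub>v v) \<bullet>c (A *\<^sub>v v)"
      using cscalar_prod_mat_adjoint[OF A' Av v] by simp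
    finally show ?thesis by (simp add: cscalar_prod_self)
  qed
  \<comment> \<open>At an eigenvector v, s |v|^2 = |Av|^2, which forces s >= 0; the root of s is
    then a singular value.\<close>
  have sv: "sqrt s \<in> singular_values A" and nonneg: "0 \<le> s"
    if ev: "eigenvalue H (complex_of_real s)" for s
  proof -
    obtain v where v: "v \<in> carrier_vec n" "v \<noteq> 0\<^sub>v n" "H *\<^sub>v v = complex_of_real s \<cdot>\<^sub>v v"
      using ev H unfolding eigenvalue_def eigenvector_def by auto
    have "complex_of_real s * (v \<bullet>c v) = complex_of_real (sq_norm_cvec (A *\<^sub>v v))"
      using form[OF v(1)] v by simp
    then have "s * sq_norm_cvec v = sq_norm_cvec (A *\<^sub>v v)"
      unfolding cscalar_prod_self using of_real_eq_iff of_real_mult by metis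
    then show "0 \<le> s"
      using sq_norm_cvec_pos[OF v(1,2)] sq_norm_cvec_nonneg[of "A *\<^sub>v v"]
      by (metis not_less mult_neg_pos)
    then show "sqrt s \<in> singular_values A"
      using ev A n by (simp add: singular_values_def H_def flip: of_real_power)
  qed
  obtain s where s: "eigenvalue H (complex_of_real s)"
    "\<And>v. v \<in> carrier_vec n \<Longrightarrow> s * sq_norm_cvec v \<le> sq_norm_cvec (A *\<^sub>v v)"
    using hermitian_eigenvalue_lower_bound[OF H herm n(1)] form by (metis Re_complex_of_real)
  have uminus_mult: "(- H) *\<^sub>v v = - (H *\<^sub>v v)" if "v \<in> carrier_vec n" for v
    using H that by (intro eq_vecI) auto
  have "mat_adjoint (- H) = - H"
  proof (intro eq_matI)
    fix i j assume "i < dim_row (- H)" "j < dim_col (- H)"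
    then show "mat_adjoint (- H) $$ (i, j) = (- H) $$ (i, j)"
      using H arg_cong[OF herm, of "\<lambda>A. A $$ (i, j)"] by simp
  qed (use H in auto)
  \<comment> \<open>Here -t is the eigenvalue of H that bounds |Av|^2 / |v|^2 from above.\<close>
  then obtain t where t: "eigenvalue (- H) (complex_of_real t)"
    "\<And>v. v \<in> carrier_vec n \<Longrightarrow> t * sq_norm_cvec v \<le> Re ((- H *\<^sub>v v) \<bullet>c v)"
    using hermitian_eigenvalue_lower_bound[of "- H" n] H n(1) by auto
  have t_bound: "sq_norm_cvec (A *\<^sub>v v) \<le> - t * sq_norm_cvec v" if v: "v \<in> carrier_vec n" for v
    using t(2)[OF v] form[OF v] H v by (simp add: uminus_mult)
  have "eigenvalue H (complex_of_real (- t))"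
  proof -
    obtain v where v: "v \<in> carrier_vec n" "v \<noteq> 0\<^sub>v n" "- H *\<^sub>v v = complex_of_real t \<cdot>\<^sub>v v"
      using t(1) H unfolding eigenvalue_def eigenvector_def by auto
    have "H *\<^sub>v v = - (- H *\<^sub>v v)"
      using uminus_mult[OF v(1)] by simp
    also have "\<dots> = complex_of_real (- t) \<cdot>\<^sub>v v"
      unfolding v(3) using v(1) by (intro eq_vecI) auto
    finally show ?thesis
      using v H unfolding eigenvalue_def eigenvector_def by auto
  qed
  note t = this t_bound
  \<comment> \<open>Inequalities suffice: replacing -t by \<open>sigma_max\<close> squared, or s by
    \<open>sigma_min\<close> squared, only weakens the bounds.\<close>
  have max: "sqrt (- t) \<le> sigma_max A"
    unfolding sigma_max_def using sv[OF t(1)] finite_singular_values by (rule Max_ge[rotated])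
  have min: "sigma_min A \<le> sqrt s"
    unfolding sigma_min_def using sv[OF s(1)] finite_singular_values by (rule Min_le[rotated])
  have "sigma_min A \<in> singular_values A"
    unfolding sigma_min_def using sv[OF s(1)] finite_singular_values by (intro Min_in) auto
  then show min_nonneg: "0 \<le> sigma_min A"
    and "sigma_min A \<le> sigma_max A"
    unfolding sigma_max_def using finite_singular_values
    by (simp add: singular_values_def, intro Max_ge)
  show "(sigma_min A)\<^sup>2 * sq_norm_cvec v \<le> sq_norm_cvec (A *\<^sub>v v)" if v: "v \<in> carrier_vec n"
  proof -
    have "(sigma_min A)\<^sup>2 \<le> s"
      using power_mono[OF min min_nonneg, of 2] nonneg[OF s(1)] by simp
    then show ?thesis
      using s(2)[OF v] sq_norm_cvec_nonneg[of v] by (meson mult_right_mono order_trans)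
  qed
  show "sq_norm_cvec (A *\<^sub>v v) \<le> (sigma_max A)\<^sup>2 * sq_norm_cvec v" if v: "v \<in> carrier_vec n"
  proof -
    have "- t \<le> (sigma_max A)\<^sup>2"
      using power_mono[OF max, of 2] nonneg[OF t(1)] by simp
    then show ?thesis
      using t(2)[OF v] sq_norm_cvec_nonneg[of v] by (meson mult_right_mono order_trans)
  qed
qed

section \<open>Mode products, fibre by fibre\<close>

lemma finite_multi_indices: "finite (multi_indices ds)"
proof (rule finite_subset)
  \<comment> \<open>The sum of the dimensions serves as a common bound for all of them.\<close>
  show "multi_indices ds \<subseteq> {is. set is \<subseteq> {..<sum_list ds} \<and> length is = length ds}"
    using elem_le_sum_list[of _ ds]
    by (fastforce simp: multi_indices_def in_set_conv_nth intro: order_less_le_trans)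
  show "finite {is. set is \<subseteq> {..<sum_list ds} \<and> length is = length ds}"
    by (rule finite_lists_length_eq) simp
qed

text \<open>Setting dimension n to 1 forces index n to be 0, so these \<open>js\<close> label the
  mode-n fibres, one each. The labels do not depend on \<open>d\<close>; a tensor and its mode-n
  product therefore share them.\<close>

lemma sum_multi_indices_fibres:
  fixes f :: "nat list \<Rightarrow> 'a :: comm_monoid_add"
  assumes "n < length ds"
  shows "(\<Sum>is\<in>multi_indices (ds[n := d]). f is)
    = (\<Sum>js\<in>multi_indices (ds[n := 1]). \<Sum>k<d. f (js[n := k]))"
proof -
  have "(\<Sum>is\<in>multi_indices (ds[n := d]). f is)
      = (\<Sum>(js, k)\<in>multi_indices (ds[n := 1]) \<times> {..<d}. f (js[n := k]))"
  proof (rule sum.reindex_bij_witness[of _ "\<lambda>(js, k). js[n := k]" "\<lambda>is. (is[n := 0], is ! n)"])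
    fix p assume "p \<in> multi_indices (ds[n := 1]) \<times> {..<d}"
    then obtain js k where p: "p = (js, k)" "js \<in> multi_indices (ds[n := 1])" "k < d"
      by blast
    then have "js ! n = 0" "length js = length ds"
      using assms by (auto simp: multi_indices_def)
    with p assms
    show "(case p of (js, k) \<Rightarrow> js[n := k]) \<in> multi_indices (ds[n := d])"
      and "((case p of (js, k) \<Rightarrow> js[n := k])[n := 0], (case p of (js, k) \<Rightarrow> js[n := k]) ! n) = p"
      by (auto simp: multi_indices_def nth_list_update list_update_same_conv split: if_splits)
  qed (use assms in \<open>auto simp: multi_indices_def nth_list_update split: if_splits\<close>)
  then show ?thesis
    by (simp add: sum.cartesian_product)
qed

lemma frobenius_norm_nonneg: "0 \<le> frobenius_norm T"
  by (simp add: frobenius_norm_def sum_nonneg)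

lemma frobenius_norm_square:
  "(frobenius_norm T)\<^sup>2 = (\<Sum>is\<in>multi_indices (tdims T). (cmod (entry T is))\<^sup>2)"
  by (simp add: frobenius_norm_def sum_nonneg)

lemma frobenius_norm_square_fibres:
  assumes "n < length (tdims T)"
  shows "(frobenius_norm T)\<^sup>2 = (\<Sum>js\<in>multi_indices ((tdims T)[n := 1]).
    sq_norm_cvec (vec (tdims T ! n) (\<lambda>k. entry T (js[n := k]))))"
  using sum_multi_indices_fibres[OF assms, of "\<lambda>is. (cmod (entry T is))\<^sup>2" "tdims T ! n"]
  by (simp add: frobenius_norm_square sq_norm_cvec_def)

lemma tdims_mode_prod [simp]: "tdims (mode_prod T n A) = (tdims T)[n := dim_row A]"
  by (simp add: mode_prod_def)

lemma mode_prod_fibre: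
  assumes n: "n < length (tdims T)" and A: "dim_col A = tdims T ! n"
    and js: "js \<in> multi_indices ((tdims T)[n := 1])"
  shows "vec (dim_row A) (\<lambda>i. entry (mode_prod T n A) (js[n := i]))
    = A *\<^sub>v vec (tdims T ! n) (\<lambda>k. entry T (js[n := k]))"
proof (intro eq_vecI)
  fix i assume "i < dim_vec (A *\<^sub>v vec (tdims T ! n) (\<lambda>k. entry T (js[n := k])))"
  then have i: "i < dim_row A" by simp
  have "js[n := i] \<in> multi_indices ((tdims T)[n := dim_row A])"
    using js n i by (auto simp: multi_indices_def nth_list_update split: if_splits)
  moreover have "n < length js"
    using js n by (simp add: multi_indices_def)
  ultimately show "vec (dim_row A) (\<lambda>i. entry (mode_prod T n A) (js[n := i])) $ i
      = (A *\<^sub>v vec (tdims T ! n) (\<lambda>k. entry T (js[n := k]))) $ i"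
    using i A by (simp add: mode_prod_def scalar_prod_def atLeast0LessThan mult.commute)
qed simp

lemma frobenius_norm_mode_prod_square:
  assumes "n < length (tdims T)" "dim_col A = tdims T ! n"
  shows "(frobenius_norm (mode_prod T n A))\<^sup>2 = (\<Sum>js\<in>multi_indices ((tdims T)[n := 1]).
    sq_norm_cvec (A *\<^sub>v vec (tdims T ! n) (\<lambda>k. entry T (js[n := k]))))"
proof -
  have "(frobenius_norm (mode_prod T n A))\<^sup>2 = (\<Sum>js\<in>multi_indices ((tdims T)[n := 1]).
    sq_norm_cvec (vec (dim_row A) (\<lambda>k. entry (mode_prod T n A) (js[n := k]))))"
    \<comment> \<open>The second update of position n overrides the first, so the fibre labels are
      those of \<open>T\<close>.\<close>
    using assms(1) frobenius_norm_square_fibres[of n "mode_prod T n A"] by simp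
  also have "\<dots> = (\<Sum>js\<in>multi_indices ((tdims T)[n := 1]).
    sq_norm_cvec (A *\<^sub>v vec (tdims T ! n) (\<lambda>k. entry T (js[n := k]))))"
    by (rule sum.cong[OF refl]) (subst mode_prod_fibre[OF assms], simp_all)
  finally show ?thesis .
qed

text \<open>The squares are compared fibre by fibre; nonnegativity of the larger side then allows
  taking roots.\<close>

lemma
  assumes n: "n < length (tdims T)" and A: "dim_col A = tdims T ! n"
    and dims: "0 < dim_col A" "dim_col A \<le> dim_row A"
  shows frobenius_norm_mode_prod_ge:
      "sigma_min A * frobenius_norm T \<le> frobenius_norm (mode_prod T n A)"
    and frobenius_norm_mode_prod_le:
      "frobenius_norm (mode_prod T n A) \<le> sigma_max A * frobenius_norm T"
proof -
  have carrier: "A \<in> carrier_mat (dim_row A) (dim_col A)" by simp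
  note min = sigma_min_bound[OF carrier dims] and max = sigma_max_bound[OF carrier dims]
  have "(sigma_min A * frobenius_norm T)\<^sup>2 \<le> (frobenius_norm (mode_prod T n A))\<^sup>2"
    unfolding power_mult_distrib frobenius_norm_square_fibres[OF n]
      frobenius_norm_mode_prod_square[OF n A] sum_distrib_left
    using A by (intro sum_mono min) simp
  then show "sigma_min A * frobenius_norm T \<le> frobenius_norm (mode_prod T n A)"
    using frobenius_norm_nonneg by (rule power2_le_imp_le)
  have "(frobenius_norm (mode_prod T n A))\<^sup>2 \<le> (sigma_max A * frobenius_norm T)\<^sup>2"
    unfolding power_mult_distrib frobenius_norm_square_fibres[OF n]
      frobenius_norm_mode_prod_square[OF n A] sum_distrib_left
    using A by (intro sum_mono max) simp
  moreover have "0 \<le> sigma_max A"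
    using sigma_min_nonneg[OF carrier dims] sigma_min_le_sigma_max[OF carrier dims] by simp
  ultimately show "frobenius_norm (mode_prod T n A) \<le> sigma_max A * frobenius_norm T"
    by (intro power2_le_imp_le[OF _ mult_nonneg_nonneg]) (simp_all add: frobenius_norm_nonneg)
qed

section \<open>Iterated mode products and the Tucker bounds\<close>

lemma length_tdims_tucker [simp]: "length (tdims (tucker n G X)) = length (tdims G)"
  by (induction n) auto

text \<open>The first n products change only modes below n, so mode n still has its dimension from
  \<open>G\<close> when \<open>X n\<close> is applied.\<close>

lemma tdims_tucker_nth: "n \<le> k \<Longrightarrow> tdims (tucker n G X) ! k = tdims G ! k"
  by (induction n) auto

text \<open>Induction over the modes already multiplied; each step contributes one factor, whose
  nonnegativity lets the previous bound be multiplied by it.\<close>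

lemma frobenius_norm_tucker_bounds:
  assumes "n \<le> length (tdims G)"
    and "\<And>k. k < n \<Longrightarrow> dim_col (X k) = tdims G ! k"
    and "\<And>k. k < n \<Longrightarrow> 0 < dim_col (X k)"
    and "\<And>k. k < n \<Longrightarrow> dim_col (X k) \<le> dim_row (X k)"
  shows "(\<Prod>k<n. sigma_min (X k)) * frobenius_norm G \<le> frobenius_norm (tucker n G X)
    \<and> frobenius_norm (tucker n G X) \<le> (\<Prod>k<n. sigma_max (X k)) * frobenius_norm G"
  using assms
proof (induction n)
  case 0
  show ?case by simp
next
  case (Suc n)
  let ?T = "tucker n G X"
  have IH: "(\<Prod>k<n. sigma_min (X k)) * frobenius_norm G \<le> frobenius_norm ?T
    \<and> frobenius_norm ?T \<le> (\<Prod>k<n. sigma_max (X k)) * frobenius_norm G"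
    by (rule Suc.IH) (use Suc.prems in \<open>blast intro: less_SucI Suc_leD\<close>)+
  have carrier: "X n \<in> carrier_mat (dim_row (X n)) (dim_col (X n))" by simp
  have dims: "0 < dim_col (X n)" "dim_col (X n) \<le> dim_row (X n)"
    using Suc.prems(3,4)[of n] by simp_all
  have n: "n < length (tdims ?T)" and col: "dim_col (X n) = tdims ?T ! n"
    using Suc.prems(1) Suc.prems(2)[of n] by (simp_all add: tdims_tucker_nth)
  have nonneg: "0 \<le> sigma_min (X n)" "0 \<le> sigma_max (X n)"
    using sigma_min_nonneg[OF carrier dims] sigma_min_le_sigma_max[OF carrier dims] by simp_all
  have "(\<Prod>k<Suc n. sigma_min (X k)) * frobenius_norm G
      = sigma_min (X n) * ((\<Prod>k<n. sigma_min (X k)) * frobenius_norm G)"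
    by simp
  also have "\<dots> \<le> sigma_min (X n) * frobenius_norm ?T"
    using IH nonneg(1) by (intro mult_left_mono) auto
  also have "\<dots> \<le> frobenius_norm (tucker (Suc n) G X)"
    using frobenius_norm_mode_prod_ge[OF n col dims] by simp
  finally have lower: "(\<Prod>k<Suc n. sigma_min (X k)) * frobenius_norm G
      \<le> frobenius_norm (tucker (Suc n) G X)" .
  have "frobenius_norm (tucker (Suc n) G X) \<le> sigma_max (X n) * frobenius_norm ?T"
    using frobenius_norm_mode_prod_le[OF n col dims] by simp
  also have "\<dots> \<le> sigma_max (X n) * ((\<Prod>k<n. sigma_max (X k)) * frobenius_norm G)"
    using IH nonneg(2) by (intro mult_left_mono) auto
  also have "\<dots> = (\<Prod>k<Suc n. sigma_max (X k)) * frobenius_norm G"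
    by simp
  finally show ?case
    using lower by blast
qed

theorem theorem6:
  fixes N :: nat
    and I J :: "nat \<Rightarrow> nat"
    and T G :: "complex tensor"
    and X :: "nat \<Rightarrow> complex mat"
    and \<alpha> \<beta> :: real
  assumes "\<And>n. n < N \<Longrightarrow> I n > 0" and "\<And>n. n < N \<Longrightarrow> J n > 0"
    and "T \<in> carrier_tensor (map I [0..<N])"
    and "G \<in> carrier_tensor (map J [0..<N])"
    and "\<And>n. n < N \<Longrightarrow> X n \<in> carrier_mat (I n) (J n)"
    and "independent_tucker N T G X"
    and "\<beta> = (\<Prod>n<N. spectral_norm (X n))"
    and "\<alpha> = \<beta> / (\<Prod>n<N. condition_number (X n))"
  shows "\<alpha> * frobenius_norm G \<le> frobenius_norm T \<and> frobenius_norm T \<le> \<beta> * frobenius_norm G"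
proof -
  have T: "T = tucker N G X" and rank: "\<And>n. n < N \<Longrightarrow> full_column_rank (X n)"
    using assms(6) by (simp_all add: independent_tucker_def)
  have tdims: "tdims G = map J [0..<N]"
    using assms(4) by (simp add: carrier_tensor_def)
  have X: "X n \<in> carrier_mat (I n) (J n)" "0 < J n" "J n \<le> I n" if "n < N" for n
    using assms(2,5)[OF that] full_column_rank_dim_le[OF rank[OF that]] by auto
  have \<beta>: "\<beta> = (\<Prod>n<N. sigma_max (X n))"
    using assms(7) by (simp add: spectral_norm_def)
  have "\<alpha> = (\<Prod>n<N. sigma_max (X n) / condition_number (X n))"
    using assms(8) \<beta> by (simp add: prod_dividef)
  also have "\<dots> = (\<Prod>n<N. sigma_min (X n))"
  proof (rule prod.cong)
    fix n assume "n \<in> {..<N}"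
    then have "n < N" by simp
    then have "0 \<le> sigma_min (X n)" "sigma_min (X n) \<le> sigma_max (X n)"
      using sigma_min_nonneg[OF X] sigma_min_le_sigma_max[OF X] by blast+
    then show "sigma_max (X n) / condition_number (X n) = sigma_min (X n)"
      \<comment> \<open>The convention x / 0 = 0 settles degenerate values: if
        \<open>sigma_max\<close> is 0, so is \<open>sigma_min\<close>, squeezed between 0 and it; if
        only \<open>sigma_min\<close> is 0, the condition number and the quotient both evaluate to
        0.\<close>
      by (cases "sigma_max (X n) = 0") (auto simp: condition_number_def)
  qed simp
  finally have \<alpha>: "\<alpha> = (\<Prod>n<N. sigma_min (X n))" .
  have "dim_col (X n) = tdims G ! n" "0 < dim_col (X n)" "dim_col (X n) \<le> dim_row (X n)"
    if "n < N" for n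
    using X[OF that] that by (auto simp: tdims)
  then show ?thesis
    unfolding T \<alpha> \<beta> by (intro frobenius_norm_tucker_bounds) (simp_all add: tdims)
qed

end
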